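(* The price of anarchy and the bicriteria are unbounded over mixed-autonomy routing games with pairwise separable affine cost functions. That is: (1) for every real $M\ge 1$ there exist a mixed-autonomy routing game with a pairwise separable affine cost function, a Wardrop equilibrium $z^{EQ}$ of it and a social optimum $z^{OPT}$ of it with $C(z^{OPT})>0$ such that $C(z^{EQ})> M\, C(z^{OPT})$; and (2) for every real $M\ge 1$ there exist a mixed-autonomy routing game with a pairwise separable affine cost function, a Wardrop equilibrium $z^{EQ}$ of it, and a social optimum $w^{OPT}$ of the same game with $M$ times as many players of each type, such that $C(z^{EQ})> C(w^{OPT})$.
   Context: A mixed-autonomy routing game (nonatomic congestion game) consists of a finite directed multigraph with $n$ edges (roads), $m$ origin-destination pairs, and for each pair $j$ a mass $\alpha_j\ge 0$ of regular vehicles and a mass $\beta_j\ge 0$ of smart vehicles to be routed from its origin to its destination (each user is infinitesimal). A routing is a vector $z=(x_1,y_1,\dots,x_n,y_n)^T\in\mathbb{R}_{\ge0}^{2n}$, where $x_i,y_i$ are the masses of regular and smart vehicles on road $i$. $\mathcal{X}$ denotes the set of feasible routings: those induced by splitting each mass $\alpha_j$, and each mass $\beta_j$, among directed paths from origin to destination of pair $j$. Pairwise separable affine cost function: the delay on road $i$ is experienced identically by both vehicle types and is $c_i(x_i,y_i)=b_i+p_i x_i+q_i y_i$ with $b_i,p_i,q_i\ge 0$. Equivalently $c(z)=Az+b$, where $A$ is block diagonal with $2\times2$ blocks $\begin{bmatrix} p_i & q_i \\ p_i & q_i \end{bmatrix}$ and $b=(b_1,b_1,\dots,b_n,b_n)^T$.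 Social cost: $C(z)=\langle c(z),z\rangle$. A social optimum is a feasible routing attaining $\inf_{z\in\mathcal{X}}C(z)$. A Wardrop equilibrium is a feasible routing in which, for each origin-destination pair and each vehicle type, all paths used by that type for that pair have equal delay (sum of delays of the roads on the path), and no unused path for that pair has smaller delay. The price of anarchy of a game is the largest ratio of the social cost of a Wardrop equilibrium to the social cost of a social optimum. A bicriteria bound is a factor $p$ such that the social cost of a Wardrop equilibrium never exceeds the optimal social cost for routing $p$ times as much traffic of each type. "The same game with $p$ times as many players of each type" means the same network and cost function with all masses $\alpha_j,\beta_j$ replaced by $p\alpha_j,p\beta_j$. *)

theory Defs
  imports Complex_Main "Graph_Theory.Arc_Walk"
begin

datatype vehicle = Regular | Smart

text \<open>A routing gives the mass \<open>z e t\<close> of vehicles of type \<open>t\<close> on road \<open>e\<close>; the usual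
  \<open>x\<close> and \<open>y\<close> on road \<open>e\<close> are \<open>z e Regular\<close> and \<open>z e Smart\<close>.\<close>

type_synonym 'e routing = "'e \<Rightarrow> vehicle \<Rightarrow> real"

text \<open>The origin-destination pairs are indexed by \<open>j < num_pairs\<close>. The cost function maps a whole
  routing to a delay for every road and vehicle type.\<close>

record ('v, 'e) routing_game =
  network :: "('v, 'e) pre_digraph"
  num_pairs :: nat
  origin :: "nat \<Rightarrow> 'v"
  destination :: "nat \<Rightarrow> 'v"
  demand :: "nat \<Rightarrow> vehicle \<Rightarrow> real"
  cost :: "'e routing \<Rightarrow> 'e routing"

definition mixed_autonomy_game :: "('v, 'e) routing_game \<Rightarrow> bool" where
  "mixed_autonomy_game \<Gamma> \<longleftrightarrow>
     fin_digraph (network \<Gamma>) \<and>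
     (\<forall>j < num_pairs \<Gamma>. origin \<Gamma> j \<in> verts (network \<Gamma>) \<and>
        destination \<Gamma> j \<in> verts (network \<Gamma>) \<and> (\<forall>t. demand \<Gamma> j t \<ge> 0))"

definition pairwise_separable_affine :: "('v, 'e) routing_game \<Rightarrow> bool" where
  "pairwise_separable_affine \<Gamma> \<longleftrightarrow>
     (\<exists>b p q :: 'e \<Rightarrow> real.
        (\<forall>e \<in> arcs (network \<Gamma>). b e \<ge> 0 \<and> p e \<ge> 0 \<and> q e \<ge> 0) \<and>
        (\<forall>z. \<forall>e \<in> arcs (network \<Gamma>). \<forall>t.
           cost \<Gamma> z e t = b e + p e * z e Regular + q e * z e Smart))"

text \<open>Paths do not repeat vertices; in a finite multigraph there are finitely many
  of them (\<open>apaths_finite\<close>), so the sums over paths below are finite.\<close>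

definition od_paths :: "('v, 'e) routing_game \<Rightarrow> nat \<Rightarrow> 'e list set" where
  "od_paths \<Gamma> j = {P. pre_digraph.apath (network \<Gamma>) (origin \<Gamma> j) P (destination \<Gamma> j)}"

definition path_flow ::
    "('v, 'e) routing_game \<Rightarrow> (nat \<Rightarrow> vehicle \<Rightarrow> 'e list \<Rightarrow> real) \<Rightarrow> bool" where
  "path_flow \<Gamma> f \<longleftrightarrow>
     (\<forall>j < num_pairs \<Gamma>. \<forall>t. (\<forall>P \<in> od_paths \<Gamma> j. f j t P \<ge> 0) \<and>
        (\<Sum>P \<in> od_paths \<Gamma> j. f j t P) = demand \<Gamma> j t)"

definition induced_routing ::
    "('v, 'e) routing_game \<Rightarrow> (nat \<Rightarrow> vehicle \<Rightarrow> 'e list \<Rightarrow> real) \<Rightarrow> 'e routing" where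
  "induced_routing \<Gamma> f = (\<lambda>e t. \<Sum>j < num_pairs \<Gamma>. \<Sum>P \<in> {P \<in> od_paths \<Gamma> j. e \<in> set P}. f j t P)"

definition feasible :: "('v, 'e) routing_game \<Rightarrow> 'e routing set" where
  "feasible \<Gamma> = {induced_routing \<Gamma> f | f. path_flow \<Gamma> f}"

definition social_cost :: "('v, 'e) routing_game \<Rightarrow> 'e routing \<Rightarrow> real" where
  "social_cost \<Gamma> z =
     (\<Sum>e \<in> arcs (network \<Gamma>). cost \<Gamma> z e Regular * z e Regular + cost \<Gamma> z e Smart * z e Smart)"

definition social_optimum :: "('v, 'e) routing_game \<Rightarrow> 'e routing \<Rightarrow> bool" where
  "social_optimum \<Gamma> z \<longleftrightarrow>
     z \<in> feasible \<Gamma> \<and> (\<forall>w \<in> feasible \<Gamma>. social_cost \<Gamma> z \<le> social_cost \<Gamma> w)"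

definition path_delay ::
    "('v, 'e) routing_game \<Rightarrow> 'e routing \<Rightarrow> vehicle \<Rightarrow> 'e list \<Rightarrow> real" where
  "path_delay \<Gamma> z t P = (\<Sum>e \<leftarrow> P. cost \<Gamma> z e t)"

text \<open>Which paths are used is not determined by the masses on the roads, so an equilibrium
  comes with some path flow inducing it.\<close>

definition wardrop_equilibrium :: "('v, 'e) routing_game \<Rightarrow> 'e routing \<Rightarrow> bool" where
  "wardrop_equilibrium \<Gamma> z \<longleftrightarrow>
     (\<exists>f. path_flow \<Gamma> f \<and> z = induced_routing \<Gamma> f \<and>
        (\<forall>j < num_pairs \<Gamma>. \<forall>t. \<forall>P \<in> od_paths \<Gamma> j. \<forall>Q \<in> od_paths \<Gamma> j. f j t P > 0 \<longrightarrow>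
           (f j t Q > 0 \<longrightarrow> path_delay \<Gamma> z t P = path_delay \<Gamma> z t Q) \<and>
           (f j t Q = 0 \<longrightarrow> path_delay \<Gamma> z t P \<le> path_delay \<Gamma> z t Q)))"

definition scale_demand :: "real \<Rightarrow> ('v, 'e) routing_game \<Rightarrow> ('v, 'e) routing_game" where
  "scale_demand r \<Gamma> = \<Gamma>\<lparr>demand := (\<lambda>j t. r * demand \<Gamma> j t)\<rparr>"

end

(*
  Two parallel roads serve one origin-destination pair, with delays eps + x on the first road and
  eps + y on the second, so that each road is congested by one vehicle type only.  Sending every
  type along the road which it congests is a Wardrop equilibrium by symmetry; exchanging the two
  types leaves only the fixed delay eps, which is a lower bound for every user in every routing.
*)
theory Submission
  imports Defs
begin

definition parallel_roads :: "(nat, nat) pre_digraph" where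
  "parallel_roads = \<lparr>verts = {0, 1}, arcs = {0, 1}, tail = (\<lambda>_. 0), head = (\<lambda>_. 1)\<rparr>"

text \<open>Both types share the demand \<open>r\<close>, so scaling the demand stays within this
  family and the scaled game needs no analysis of its own.\<close>

definition two_road_game :: "real \<Rightarrow> real \<Rightarrow> (nat, nat) routing_game" where
  "two_road_game \<epsilon> r =
     \<lparr>network = parallel_roads, num_pairs = 1, origin = (\<lambda>_. 0), destination = (\<lambda>_. 1),
      demand = (\<lambda>_ _. r),
      cost = (\<lambda>z e _. \<epsilon> + (if e = 0 then z e Regular else z e Smart))\<rparr>"

lemma two_road_game_simps [simp]:
  "network (two_road_game \<epsilon> r) = parallel_roads"
  "num_pairs (two_road_game \<epsilon> r) = 1"
  "origin (two_road_game \<epsilon> r) j = 0"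
  "destination (two_road_game \<epsilon> r) j = 1"
  "demand (two_road_game \<epsilon> r) j t = r"
  "cost (two_road_game \<epsilon> r) z e t = \<epsilon> + (if e = 0 then z e Regular else z e Smart)"
  "verts parallel_roads = {0, 1}"
  "arcs parallel_roads = {0, 1}"
  "tail parallel_roads e = 0"
  "head parallel_roads e = 1"
  by (simp_all add: two_road_game_def parallel_roads_def)

lemma scale_demand_two_road_game:
  "scale_demand s (two_road_game \<epsilon> r) = two_road_game \<epsilon> (s * r)"
  by (simp add: scale_demand_def two_road_game_def)

lemma mixed_autonomy_two_road_game:
  "r \<ge> 0 \<Longrightarrow> mixed_autonomy_game (two_road_game \<epsilon> r)"
  unfolding mixed_autonomy_game_def by (auto intro!: fin_digraph.intro wf_digraph.intro
      fin_digraph_axioms.intro)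

lemma pairwise_separable_affine_two_road_game:
  assumes "\<epsilon> \<ge> 0"
  shows "pairwise_separable_affine (two_road_game \<epsilon> r)"
  unfolding pairwise_separable_affine_def
  by (rule exI[of _ "\<lambda>_. \<epsilon>"], rule exI[of _ "\<lambda>e. if e = 0 then 1 else 0"],
      rule exI[of _ "\<lambda>e. if e = 0 then 0 else 1"]) (use assms in auto)

text \<open>Every arc ends in 1 and starts in 0, so no second arc can follow a first one, and the
  empty walk does not join 0 to 1.\<close>

lemma od_paths_two_road_game [simp]: "od_paths (two_road_game \<epsilon> r) j = {[0], [1]}"
proof -
  have "pre_digraph.cas parallel_roads 0 P 1 \<longleftrightarrow> (\<exists>e. P = [e])" for P
  proof (cases P)
    case (Cons e es)
    then show ?thesis
      by (cases es) (auto simp: pre_digraph.cas.simps)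
  qed (simp add: pre_digraph.cas.simps)
  then show ?thesis
    by (auto simp: od_paths_def pre_digraph.apath_def pre_digraph.awalk_def
        pre_digraph.awalk_verts.simps)
qed

text \<open>As every path is a single road, path flows and road masses are the same data; any other
  \<open>e\<close> lies on no path and gets an empty sum.\<close>

lemma induced_routing_two_road_game:
  "induced_routing (two_road_game \<epsilon> r) f e t = (if e \<in> {0, 1} then f 0 t [e] else 0)"
proof -
  have "{P. (P = [0] \<or> P = [Suc 0]) \<and> e \<in> set P} = (if e \<in> {0, 1} then {[e]} else {})"
    by auto
  then show ?thesis
    by (simp add: induced_routing_def)
qed

lemma path_flow_two_road_game:
  "path_flow (two_road_game \<epsilon> r) f \<longleftrightarrow>
     (\<forall>t. f 0 t [0] \<ge> 0 \<and> f 0 t [1] \<ge> 0 \<and> f 0 t [0] + f 0 t [1] = r)"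
  by (auto simp: path_flow_def)

lemma social_cost_two_road_game:
  "social_cost (two_road_game \<epsilon> r) z =
     \<epsilon> * (z 0 Regular + z 0 Smart + z 1 Regular + z 1 Smart) +
     z 0 Regular * (z 0 Regular + z 0 Smart) + z 1 Smart * (z 1 Regular + z 1 Smart)"
  by (simp add: social_cost_def algebra_simps)

lemma social_cost_two_road_game_ge:
  assumes "z \<in> feasible (two_road_game \<epsilon> r)"
  shows "social_cost (two_road_game \<epsilon> r) z \<ge> 2 * r * \<epsilon>"
proof -
  obtain f where f: "path_flow (two_road_game \<epsilon> r) f"
    and z: "z = induced_routing (two_road_game \<epsilon> r) f"
    using assms by (auto simp: feasible_def)
  have nonneg: "z e t \<ge> 0" for e t
    using f by (auto simp: z induced_routing_two_road_game path_flow_two_road_game)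
  have total: "z 0 t + z 1 t = r" for t
    using f by (simp add: z induced_routing_two_road_game path_flow_two_road_game)
  \<comment> \<open>The total mass on the roads is fixed by the demands, which makes the
    \<open>\<epsilon>\<close> term constant on feasible routings. What remains are products of
    nonnegative masses.\<close>
  have "z 0 Regular + z 0 Smart + z 1 Regular + z 1 Smart = 2 * r"
    using total[of Regular] total[of Smart] by simp
  then have "social_cost (two_road_game \<epsilon> r) z =
      \<epsilon> * (2 * r) + z 0 Regular * (z 0 Regular + z 0 Smart) + z 1 Smart * (z 1 Regular + z 1 Smart)"
    by (simp only: social_cost_two_road_game)
  then show ?thesis
    by (simp add: nonneg)
qed

text \<open>The parameter \<open>u\<close> is the type sent along road 0, the other type taking road
  1: \<open>Regular\<close> yields the bad equilibrium, \<open>Smart\<close> the optimum.\<close>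

definition two_road_routing :: "real \<Rightarrow> vehicle \<Rightarrow> nat routing" where
  "two_road_routing r u e t =
     (if e = 0 \<and> t = u \<or> e = 1 \<and> t \<noteq> u then r else 0)"

text \<open>On a one-road path \<open>hd P\<close> is the road itself, so the road masses can be
  read back as a path flow.\<close>

lemma two_road_routing_flow:
  assumes "r \<ge> 0"
  shows "path_flow (two_road_game \<epsilon> r) (\<lambda>_ t P. two_road_routing r u (hd P) t)"
    and "induced_routing (two_road_game \<epsilon> r) (\<lambda>_ t P. two_road_routing r u (hd P) t) =
      two_road_routing r u"
  using assms
  by (auto simp: path_flow_two_road_game two_road_routing_def fun_eq_iff
      induced_routing_two_road_game)

text \<open>Road 0 carries no regular and road 1 no smart vehicles, so both congestion terms vanish
  and the lower bound is attained.\<close>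

lemma social_optimum_two_road_game:
  assumes "r \<ge> 0"
  shows "social_optimum (two_road_game \<epsilon> r) (two_road_routing r Smart)"
    and "social_cost (two_road_game \<epsilon> r) (two_road_routing r Smart) = 2 * r * \<epsilon>"
proof -
  show cost: "social_cost (two_road_game \<epsilon> r) (two_road_routing r Smart) = 2 * r * \<epsilon>"
    by (simp add: social_cost_two_road_game two_road_routing_def)
  have "two_road_routing r Smart \<in> feasible (two_road_game \<epsilon> r)"
    unfolding feasible_def using two_road_routing_flow[OF assms, of \<epsilon> Smart]
    by (metis (mono_tags, lifting) mem_Collect_eq)
  then show "social_optimum (two_road_game \<epsilon> r) (two_road_routing r Smart)"
    by (simp add: social_optimum_def cost social_cost_two_road_game_ge)
qed

lemma wardrop_equilibrium_two_road_game:
  assumes "r \<ge> 0"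
  shows "wardrop_equilibrium (two_road_game \<epsilon> r) (two_road_routing r Regular)"
    and "social_cost (two_road_game \<epsilon> r) (two_road_routing r Regular) = 2 * r * (r + \<epsilon>)"
proof -
  \<comment> \<open>Each road carries mass \<open>r\<close> of the type that congests it. With equal
    delays on both paths, the equilibrium conditions hold whichever paths are used.\<close>
  have "path_delay (two_road_game \<epsilon> r) (two_road_routing r Regular) t P = \<epsilon> + r"
    if "P \<in> {[0], [1]}" for t P
    using that by (auto simp: path_delay_def two_road_routing_def)
  then show "wardrop_equilibrium (two_road_game \<epsilon> r) (two_road_routing r Regular)"
    unfolding wardrop_equilibrium_def using two_road_routing_flow[OF assms, of \<epsilon> Regular]
    by (intro exI[of _ "\<lambda>_ t P. two_road_routing r Regular (hd P) t"]) simp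
  show "social_cost (two_road_game \<epsilon> r) (two_road_routing r Regular) = 2 * r * (r + \<epsilon>)"
    by (simp add: social_cost_two_road_game two_road_routing_def algebra_simps)
qed

theorem proposition1:
  shows "(\<forall>M::real. M \<ge> 1 \<longrightarrow>
            (\<exists>(\<Gamma> :: (nat, nat) routing_game) zEQ zOPT.
               mixed_autonomy_game \<Gamma> \<and> pairwise_separable_affine \<Gamma> \<and>
               wardrop_equilibrium \<Gamma> zEQ \<and> social_optimum \<Gamma> zOPT \<and>
               social_cost \<Gamma> zOPT > 0 \<and>
               social_cost \<Gamma> zEQ > M * social_cost \<Gamma> zOPT))
       \<and> (\<forall>M::real. M \<ge> 1 \<longrightarrow>
            (\<exists>(\<Gamma> :: (nat, nat) routing_game) zEQ wOPT.
               mixed_autonomy_game \<Gamma> \<and> pairwise_separable_affine \<Gamma> \<and>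
               wardrop_equilibrium \<Gamma> zEQ \<and> social_optimum (scale_demand M \<Gamma>) wOPT \<and>
               social_cost \<Gamma> zEQ > social_cost (scale_demand M \<Gamma>) wOPT))"
proof -
  \<comment> \<open>The fixed delay \<open>1 / (2 * M)\<close> makes the optimum cost
    \<open>1 / M\<close> at unit demand and exactly 1 at demand \<open>M\<close>, while the
    equilibrium always costs more than 2. The same game thus serves both claims.\<close>
  define \<Gamma> where "\<Gamma> M = two_road_game (1 / (2 * M)) 1" for M :: real
  have game: "mixed_autonomy_game (\<Gamma> M)" "pairwise_separable_affine (\<Gamma> M)" if "M \<ge> 1" for M
    using that by (simp_all add: \<Gamma>_def mixed_autonomy_two_road_game
        pairwise_separable_affine_two_road_game)
  have eq: "wardrop_equilibrium (\<Gamma> M) (two_road_routing 1 Regular)"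
    "social_cost (\<Gamma> M) (two_road_routing 1 Regular) = 2 + 1 / M" for M
    by (simp_all add: \<Gamma>_def wardrop_equilibrium_two_road_game)
  have opt: "social_optimum (\<Gamma> M) (two_road_routing 1 Smart)"
    "social_cost (\<Gamma> M) (two_road_routing 1 Smart) = 1 / M" for M
    by (simp_all add: \<Gamma>_def social_optimum_two_road_game)
  have scaled_opt: "social_optimum (scale_demand M (\<Gamma> M)) (two_road_routing M Smart)"
    "social_cost (scale_demand M (\<Gamma> M)) (two_road_routing M Smart) = 1" if "M \<ge> 1" for M
    using that by (simp_all add: \<Gamma>_def scale_demand_two_road_game social_optimum_two_road_game)
  show ?thesis
  proof (intro conjI allI impI)
    fix M :: real
    assume M: "M \<ge> 1"
    have pos: "1 / M > 0"
      using M by simp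
    \<comment> \<open>The right side is \<open>M\<close> times the optimal cost and equals
      1.\<close>
    have "2 + 1 / M > M * (1 / M)"
      using M pos by (simp add: add_pos_pos)
    with M pos show "\<exists>(\<Gamma> :: (nat, nat) routing_game) zEQ zOPT.
        mixed_autonomy_game \<Gamma> \<and> pairwise_separable_affine \<Gamma> \<and>
        wardrop_equilibrium \<Gamma> zEQ \<and> social_optimum \<Gamma> zOPT \<and>
        social_cost \<Gamma> zOPT > 0 \<and> social_cost \<Gamma> zEQ > M * social_cost \<Gamma> zOPT"
      using game eq opt by metis
    have "2 + 1 / M > 1"
      using pos by linarith
    with M show "\<exists>(\<Gamma> :: (nat, nat) routing_game) zEQ wOPT.
        mixed_autonomy_game \<Gamma> \<and> pairwise_separable_affine \<Gamma> \<and>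
        wardrop_equilibrium \<Gamma> zEQ \<and> social_optimum (scale_demand M \<Gamma>) wOPT \<and>
        social_cost \<Gamma> zEQ > social_cost (scale_demand M \<Gamma>) wOPT"
      using game eq scaled_opt by metis
  qed
qed

end
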